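(* Let $N\in\mathbb{N}$ and let $Y$ be an $F$-space with homogeneous metric $d_Y$. Let $X$ be a nonempty connected set and $\{X_i : i=1,\dots,N\}$ a collection of nonempty connected subsets of $X$. Suppose $u_i:X_i\to X$, $i=1,\dots,N$, are mappings, each a bijection onto its image $u_i(X_i)$, such that $X=\bigcup_{i=1}^N u_i(X_i)$ and $u_i(X_i)\cap u_j(X_j)=\emptyset$ for all $i\ne j$. Let $\lambda=(\lambda_1,\dots,\lambda_N)\in\prod_{i=1}^N B(X_i,Y)$ and $S=(S_1,\dots,S_N)\in\prod_{i=1}^N B(X_i,\mathbb{R})$. Define $\Phi=\Phi(\lambda)(S):B(X,Y)\to B(X,Y)$ by $$\Phi f=\sum_{i=1}^N (\lambda_i\circ u_i^{-1})\,\chi_{u_i(X_i)}+\sum_{i=1}^N (S_i\circ u_i^{-1})\cdot(f_i\circ u_i^{-1})\,\chi_{u_i(X_i)},\qquad f_i:=f|_{X_i}.$$ If $\max\{\|S_i\|_{\infty,X_i} : i=1,\dots,N\}<1$, then $\Phi$ is contractive on the complete metric space $(B(X,Y),d)$ and its unique fixed point $\mathfrak{f}\in B(X,Y)$ satisfies the self-referential equation $$\mathfrak{f}=\sum_{i=1}^N (\lambda_i\circ u_i^{-1})\,\chi_{u_i(X_i)}+\sum_{i=1}^N (S_i\circ u_i^{-1})\cdot(\mathfrak{f}_i\circ u_i^{-1})\,\chi_{u_i(X_i)},\qquad \mathfrak f_i:=\mathfrak f|_{X_i},$$ or, equivalently, $\mathfrak{f}\circ u_i=\lambda_i+S_i\cdot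 \mathfrak{f}_i$ on $X_i$ for all $i=1,\dots,N$.
   Context: An $F$-space is a (real) topological vector space whose topology is induced by a complete translation-invariant metric $d_Y$. The metric is homogeneous if $d_Y(\alpha y_1,\alpha y_2)=|\alpha|\,d_Y(y_1,y_2)$ for all $\alpha\in\mathbb{R}$, $y_1,y_2\in Y$. A map $f:X\to Y$ is bounded if there is $M>0$ with $d_Y(f(x_1),f(x_2))<M$ for all $x_1,x_2\in X$. $B(X,Y)$ is the set of all bounded maps $X\to Y$, equipped with the metric $d(f,g)=\sup_{x\in X}d_Y(f(x),g(x))$; $B(X_i,Y)$ and $B(X_i,\mathbb{R})$ are defined in the same way. $\|\cdot\|_{\infty,X_i}$ is the supremum norm over $X_i$, and $\chi_M$ is the characteristic function of $M$ (each term with $\chi_{u_i(X_i)}$ is understood to be $0$ off $u_i(X_i)$). "Contractive" means Lipschitz with some constant $c\in[0,1)$. *)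

theory Defs
  imports "HOL-Analysis.Analysis"
begin

definition real_tvs_topology :: "'y::real_vector topology \<Rightarrow> bool" where
  "real_tvs_topology T \<longleftrightarrow>
     topspace T = UNIV \<and>
     continuous_map (prod_topology T T) T (\<lambda>(x, y). x + y) \<and>
     continuous_map (prod_topology euclideanreal T) T (\<lambda>(a, y). a *\<^sub>R y)"

locale F_space = Metric_space UNIV d
  for d :: "'y::real_vector \<Rightarrow> 'y \<Rightarrow> real" +
  assumes tvs: "real_tvs_topology mtopology"
    and complete: "mcomplete"
    and translation_invariant: "d (x + z) (y + z) = d x y"

definition homogeneous_metric :: "('y::real_vector \<Rightarrow> 'y \<Rightarrow> real) \<Rightarrow> bool" where
  "homogeneous_metric d \<longleftrightarrow> (\<forall>a x y. d (a *\<^sub>R x) (a *\<^sub>R y) = \<bar>a\<bar> * d x y)"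

text \<open>Maps with domain \<open>X\<close> are functions that are \<open>undefined\<close> outside \<open>X\<close>, so that
  the uniform distance separates them.\<close>

abbreviation bounded_maps :: "('y \<Rightarrow> 'y \<Rightarrow> real) \<Rightarrow> 'x set \<Rightarrow> ('x \<Rightarrow> 'y) set" where
  "bounded_maps d X \<equiv> Metric_space.fspace UNIV d X"

abbreviation uniform_dist :: "('y \<Rightarrow> 'y \<Rightarrow> real) \<Rightarrow> 'x set \<Rightarrow> ('x \<Rightarrow> 'y) \<Rightarrow> ('x \<Rightarrow> 'y) \<Rightarrow> real" where
  "uniform_dist d X \<equiv> Metric_space.fdist UNIV d X"

lemma bounded_maps_iff:
  assumes "Metric_space (UNIV :: 'y set) d"
  shows "f \<in> bounded_maps d X \<longleftrightarrow>
    f \<in> extensional X \<and> (\<exists>M>0. \<forall>x1\<in>X. \<forall>x2\<in>X. d (f x1) (f x2) < M)"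
proof -
  interpret Metric_space "UNIV :: 'y set" d by fact
  have "mbounded (f ` X) \<longleftrightarrow> (\<exists>M>0. \<forall>x1\<in>X. \<forall>x2\<in>X. d (f x1) (f x2) < M)"
    unfolding mbounded_alt_pos
    by simp (meson gt_ex le_less_trans less_imp_le less_trans)
  then show ?thesis by (auto simp: fspace_def)
qed

lemma uniform_dist_eq:
  assumes "Metric_space (UNIV :: 'y set) d" "X \<noteq> {}"
    and "f \<in> bounded_maps d X" "g \<in> bounded_maps d X"
  shows "uniform_dist d X f g = (SUP x\<in>X. d (f x) (g x))"
  using assms by (simp add: Metric_space.fdist_def)

definition sup_norm :: "'x set \<Rightarrow> ('x \<Rightarrow> real) \<Rightarrow> real" where
  "sup_norm A s = (SUP x\<in>A. \<bar>s x\<bar>)"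

definition contractive_on :: "'a set \<Rightarrow> ('a \<Rightarrow> 'a \<Rightarrow> real) \<Rightarrow> ('a \<Rightarrow> 'a) \<Rightarrow> bool" where
  "contractive_on M d F \<longleftrightarrow>
     (\<exists>c. 0 \<le> c \<and> c < 1 \<and> (\<forall>x\<in>M. \<forall>y\<in>M. d (F x) (F y) \<le> c * d x y))"

text \<open>Off \<open>u i ` D i\<close> the value of \<open>inv_into (D i) (u i)\<close> is arbitrary, but the indicator
  annihilates the term.\<close>

definition read_bajraktarevic ::
  "nat \<Rightarrow> 'x set \<Rightarrow> (nat \<Rightarrow> 'x set) \<Rightarrow> (nat \<Rightarrow> 'x \<Rightarrow> 'x) \<Rightarrow>
   (nat \<Rightarrow> 'x \<Rightarrow> 'y::real_vector) \<Rightarrow> (nat \<Rightarrow> 'x \<Rightarrow> real) \<Rightarrow> ('x \<Rightarrow> 'y) \<Rightarrow> ('x \<Rightarrow> 'y)" where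
  "read_bajraktarevic N X D u lam S f = (\<lambda>x\<in>X.
     (\<Sum>i=1..N. indicator (u i ` D i) x *\<^sub>R lam i (inv_into (D i) (u i) x)) +
     (\<Sum>i=1..N. indicator (u i ` D i) x *\<^sub>R
        (S i (inv_into (D i) (u i) x) *\<^sub>R restrict f (D i) (inv_into (D i) (u i) x))))"

end

theory Submission
  imports Defs
begin

text \<open>
  Since the cells \<open>u i ` D i\<close> partition \<open>X\<close> and each \<open>u i\<close> is injective on \<open>D i\<close>, every
  point of \<open>X\<close> is \<open>u i x\<close> for exactly one \<open>i\<close> and one \<open>x \<in> D i\<close>, and both indicator sums
  collapse there to their \<open>i\<close>-th summand (\<open>sum_cells_at_branch\<close>). So the operator is described
  by \<open>\<Phi> f (u i x) = lam i x + S i x *\<^sub>R f x\<close>, which is already the equivalence of the two forms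
  of the self-referential equation.

  The rest is Banach's fixed point theorem in the space of bounded maps, which is complete in the
  uniform metric because \<open>Y\<close> is complete. In the difference of \<open>\<Phi> f\<close> and \<open>\<Phi> g\<close> at \<open>u i x\<close>
  translation invariance cancels \<open>lam i x\<close> and homogeneity extracts the factor \<open>\<bar>S i x\<bar>\<close>
  (\<open>dist_affine\<close>), so the largest of the norms \<open>sup_norm (D i) (S i)\<close> is a contraction constant.
  The same two properties of the metric show that \<open>\<Phi> f\<close> is bounded on each cell
  (\<open>mbounded_affine\<close>), hence on \<open>X\<close>, which is the union of finitely many cells.
\<close>

text \<open>Disjointness kills every summand but the \<open>i\<close>-th; injectivity makes \<open>inv_into\<close> return \<open>x\<close>
  in that one.\<close>

lemma sum_cells_at_branch:
  fixes g :: "'i \<Rightarrow> 'x \<Rightarrow> 'y::real_vector"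
  assumes "finite I" and i: "i \<in> I" and x: "x \<in> D i"
    and inj: "inj_on (u i) (D i)"
    and disj: "\<And>j. j \<in> I \<Longrightarrow> j \<noteq> i \<Longrightarrow> u i ` D i \<inter> u j ` D j = {}"
  shows "(\<Sum>j\<in>I. indicator (u j ` D j) (u i x) *\<^sub>R g j (inv_into (D j) (u j) (u i x))) = g i x"
proof -
  have "indicator (u j ` D j) (u i x) *\<^sub>R g j (inv_into (D j) (u j) (u i x)) =
      (if j = i then g i x else 0)" if "j \<in> I" for j
  proof (cases "j = i")
    case True
    then show ?thesis using x inj by (simp add: inv_into_f_f)
  next
    case False
    then have "u i x \<notin> u j ` D j" using disj[OF that] x by blast
    then show ?thesis using False by simp
  qed
  then have "(\<Sum>j\<in>I. indicator (u j ` D j) (u i x) *\<^sub>R g j (inv_into (D j) (u j) (u i x))) =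
      (\<Sum>j\<in>I. if j = i then g i x else 0)"
    by (intro sum.cong) auto
  then show ?thesis using \<open>finite I\<close> i by (simp add: sum.delta)
qed

lemma abs_le_sup_norm:
  assumes "s \<in> bounded_maps dist A" "x \<in> A"
  shows "\<bar>s x\<bar> \<le> sup_norm A s"
proof -
  have "bounded (s ` A)"
    using assms(1) by (simp add: Met_TC.fspace_def)
  then obtain b where "\<forall>y\<in>s ` A. \<bar>y\<bar> \<le> b"
    unfolding bounded_iff real_norm_def by blast
  then have "bdd_above ((\<lambda>x. \<bar>s x\<bar>) ` A)"
    by (auto intro!: bdd_aboveI2)
  then show ?thesis
    unfolding sup_norm_def using assms(2) by (rule cSUP_upper2) simp
qed

text \<open>The first equation is the contraction estimate at a single point; the second is one
  half of the fact that the distance to \<open>0\<close> is a norm, \<open>dist_zero_add_le\<close> being the other.\<close>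

lemma (in F_space) dist_affine:
  assumes "homogeneous_metric d"
  shows "d (a + s *\<^sub>R x) (a + s *\<^sub>R y) = \<bar>s\<bar> * d x y"
    and "d 0 (s *\<^sub>R x) = \<bar>s\<bar> * d 0 x"
proof -
  have hom: "d (s *\<^sub>R x) (s *\<^sub>R y) = \<bar>s\<bar> * d x y" for x y
    using assms by (simp add: homogeneous_metric_def)
  show "d (a + s *\<^sub>R x) (a + s *\<^sub>R y) = \<bar>s\<bar> * d x y"
    using translation_invariant[of "s *\<^sub>R x" a "s *\<^sub>R y"] hom by (simp add: add.commute)
  show "d 0 (s *\<^sub>R x) = \<bar>s\<bar> * d 0 x"
    using hom[of 0 x] by simp
qed

lemma (in F_space) dist_zero_add_le: "d 0 (x + y) \<le> d 0 x + d 0 y"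
proof -
  have "d 0 (x + y) \<le> d 0 x + d x (x + y)"
    by (rule triangle) auto
  also have "d x (x + y) = d 0 y"
    using translation_invariant[of 0 x y] by (simp add: add.commute)
  finally show ?thesis .
qed

lemma (in F_space) mbounded_iff_dist_zero: "mbounded A \<longleftrightarrow> (\<exists>b. \<forall>y\<in>A. d 0 y \<le> b)"
proof
  assume "mbounded A"
  then have "mbounded (insert 0 A)" by (simp add: mbounded_insert)
  then show "\<exists>b. \<forall>y\<in>A. d 0 y \<le> b" unfolding mbounded_alt by blast
next
  assume "\<exists>b. \<forall>y\<in>A. d 0 y \<le> b"
  then show "mbounded A" unfolding mbounded by blast
qed

text \<open>Metric boundedness means a bounded distance to \<open>0\<close>; by homogeneity the scalar factor
  multiplies that distance by at most \<open>c\<close>, and addition adds the two bounds.\<close>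

lemma (in F_space) mbounded_affine:
  assumes hom: "homogeneous_metric d"
    and "mbounded (l ` A)" and "mbounded (f ` A)"
    and s: "\<And>x. x \<in> A \<Longrightarrow> \<bar>s x\<bar> \<le> c"
  shows "mbounded ((\<lambda>x. l x + s x *\<^sub>R f x) ` A)"
proof -
  obtain b1 b2 where b1: "\<And>x. x \<in> A \<Longrightarrow> d 0 (l x) \<le> b1" and b2: "\<And>x. x \<in> A \<Longrightarrow> d 0 (f x) \<le> b2"
    using assms(2,3) unfolding mbounded_iff_dist_zero by blast
  have "d 0 (l x + s x *\<^sub>R f x) \<le> b1 + c * b2" if "x \<in> A" for x
  proof -
    have "d 0 (l x + s x *\<^sub>R f x) \<le> d 0 (l x) + \<bar>s x\<bar> * d 0 (f x)"
      using dist_zero_add_le dist_affine(2)[OF hom] by metis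
    also have "\<dots> \<le> b1 + c * b2"
      using s[OF that] b1[OF that] b2[OF that] by (intro add_mono mult_mono) auto
    finally show ?thesis .
  qed
  then show ?thesis unfolding mbounded_iff_dist_zero by blast
qed

lemma (in Metric_space) mcomplete_fspace:
  "mcomplete \<Longrightarrow> Metric_space.mcomplete (fspace A) (fdist A)"
  using mcomplete_funspace[of A] by (simp add: mcomplete_of_def)

lemma (in Metric_space) contractive_on_imp_ex_unique_fixpoint:
  assumes "mcomplete" "M \<noteq> {}" "F \<in> M \<rightarrow> M" "contractive_on M d F"
  shows "\<exists>x\<in>M. F x = x \<and> (\<forall>y\<in>M. F y = y \<longrightarrow> y = x)"
proof -
  obtain c where c: "c < 1" "\<And>x y. x \<in> M \<Longrightarrow> y \<in> M \<Longrightarrow> d (F x) (F y) \<le> c * d x y"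
    using assms(4) unfolding contractive_on_def by blast
  obtain x where x: "x \<in> M" "F x = x"
    using Banach_fixedpoint_thm[OF assms(1-3) c] by blast
  have "y = x" if y: "y \<in> M" "F y = y" for y
  proof (rule ccontr)
    assume "y \<noteq> x"
    then have "d y x > 0" using x y by simp
    then have "c * d y x < d y x" using c(1) by simp
    then show False using c(2)[OF y(1) x(1)] x y by simp
  qed
  then show ?thesis using x by blast
qed

theorem theorem3:
  fixes N :: nat
    and dY :: "'y::real_vector \<Rightarrow> 'y \<Rightarrow> real"
    and X :: "'x::topological_space set"
    and D :: "nat \<Rightarrow> 'x set"
    and u :: "nat \<Rightarrow> 'x \<Rightarrow> 'x"
    and lam :: "nat \<Rightarrow> 'x \<Rightarrow> 'y"
    and S :: "nat \<Rightarrow> 'x \<Rightarrow> real"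
  defines "\<Phi> \<equiv> read_bajraktarevic N X D u lam S"
    and "B \<equiv> bounded_maps dY X"
    and "d \<equiv> uniform_dist dY X"
  assumes "N \<ge> 1"
    and "F_space dY" and "homogeneous_metric dY"
    and "X \<noteq> {}" and "connected X"
    and "\<And>i. i \<in> {1..N} \<Longrightarrow> D i \<subseteq> X \<and> D i \<noteq> {} \<and> connected (D i)"
    and "\<And>i. i \<in> {1..N} \<Longrightarrow> u i \<in> D i \<rightarrow> X"
    and "\<And>i. i \<in> {1..N} \<Longrightarrow> bij_betw (u i) (D i) (u i ` D i)"
    and "X = (\<Union>i\<in>{1..N}. u i ` D i)"
    and "\<And>i j. i \<in> {1..N} \<Longrightarrow> j \<in> {1..N} \<Longrightarrow> i \<noteq> j \<Longrightarrow> u i ` D i \<inter> u j ` D j = {}"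
    and "\<And>i. i \<in> {1..N} \<Longrightarrow> lam i \<in> bounded_maps dY (D i)"
    and "\<And>i. i \<in> {1..N} \<Longrightarrow> S i \<in> bounded_maps dist (D i)"
    and "Max ((\<lambda>i. sup_norm (D i) (S i)) ` {1..N}) < 1"
  shows "Metric_space B d \<and> Metric_space.mcomplete B d \<and>
    \<Phi> \<in> B \<rightarrow> B \<and> contractive_on B d \<Phi> \<and>
    (\<exists>f\<in>B. \<Phi> f = f \<and> (\<forall>g\<in>B. \<Phi> g = g \<longrightarrow> g = f) \<and>
      (\<forall>x\<in>X. f x =
        (\<Sum>i=1..N. indicator (u i ` D i) x *\<^sub>R lam i (inv_into (D i) (u i) x)) +
        (\<Sum>i=1..N. indicator (u i ` D i) x *\<^sub>R
          (S i (inv_into (D i) (u i) x) *\<^sub>R restrict f (D i) (inv_into (D i) (u i) x)))) \<and>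
      (\<forall>i\<in>{1..N}. \<forall>x\<in>D i. f (u i x) = lam i x + S i x *\<^sub>R restrict f (D i) x)) \<and>
    (\<forall>f\<in>B.
      (\<forall>x\<in>X. f x =
        (\<Sum>i=1..N. indicator (u i ` D i) x *\<^sub>R lam i (inv_into (D i) (u i) x)) +
        (\<Sum>i=1..N. indicator (u i ` D i) x *\<^sub>R
          (S i (inv_into (D i) (u i) x) *\<^sub>R restrict f (D i) (inv_into (D i) (u i) x)))) \<longleftrightarrow>
      (\<forall>i\<in>{1..N}. \<forall>x\<in>D i. f (u i x) = lam i x + S i x *\<^sub>R restrict f (D i) x))"
proof -
  interpret F_space dY by fact
  interpret BX: Metric_space B d
    unfolding B_def d_def by (rule Metric_space_funspace)
  have complete: "BX.mcomplete"
    unfolding B_def d_def by (rule mcomplete_fspace[OF complete])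
  note D = assms(9) and X = assms(12)
  let ?rhs = "\<lambda>f x. (\<Sum>i=1..N. indicator (u i ` D i) x *\<^sub>R lam i (inv_into (D i) (u i) x)) +
        (\<Sum>i=1..N. indicator (u i ` D i) x *\<^sub>R
          (S i (inv_into (D i) (u i) x) *\<^sub>R restrict f (D i) (inv_into (D i) (u i) x)))"

  have rhs: "?rhs f (u i x) = lam i x + S i x *\<^sub>R restrict f (D i) x"
    if "i \<in> {1..N}" "x \<in> D i" for f i x
  proof -
    have "inj_on (u i) (D i)"
      using assms(11)[OF that(1)] by (rule bij_betw_imp_inj_on)
    note cells = sum_cells_at_branch[where I = "{1..N}" and u = u and D = D, OF finite_atLeastAtMost
        that(1) that(2) this assms(13)[OF that(1)]]
    show ?thesis
      using cells[of lam] cells[of "\<lambda>j y. S j y *\<^sub>R restrict f (D j) y"] by simp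
  qed
  have Phi_X: "\<Phi> f x = ?rhs f x" if "x \<in> X" for f x
    using that by (simp add: \<Phi>_def read_bajraktarevic_def)
  have uX: "u i x \<in> X" if "i \<in> {1..N}" "x \<in> D i" for i x
    using X that by blast
  have Phi_u: "\<Phi> f (u i x) = lam i x + S i x *\<^sub>R f x" if "i \<in> {1..N}" "x \<in> D i" for f i x
    using Phi_X[OF uX[OF that]] rhs[OF that] that(2) by simp

  define c where "c = Max ((\<lambda>i. sup_norm (D i) (S i)) ` {1..N})"
  have S_le: "\<bar>S i x\<bar> \<le> c" if "i \<in> {1..N}" "x \<in> D i" for i x
  proof -
    have "\<bar>S i x\<bar> \<le> sup_norm (D i) (S i)"
      using abs_le_sup_norm[OF assms(15)[OF that(1)] that(2)] .
    also have "\<dots> \<le> c" unfolding c_def using that(1) by (intro Max_ge) auto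
    finally show ?thesis .
  qed
  have "c < 1" unfolding c_def by fact
  have "c \<ge> 0"
  proof -
    obtain i x where "i \<in> {1..N}" "x \<in> D i" using X \<open>X \<noteq> {}\<close> by blast
    then show ?thesis using S_le abs_ge_zero order_trans by blast
  qed

  have Phi_B: "\<Phi> f \<in> B" if f: "f \<in> B" for f
  proof -
    have "mbounded (\<Phi> f ` u i ` D i)" if i: "i \<in> {1..N}" for i
    proof -
      have "\<Phi> f ` u i ` D i = (\<lambda>x. lam i x + S i x *\<^sub>R f x) ` D i"
        unfolding image_image using Phi_u[OF i] by (intro image_cong) auto
      moreover have "mbounded (f ` D i)"
        using f D[OF i] unfolding B_def fspace_def by (auto elim!: mbounded_subset)
      moreover have "mbounded (lam i ` D i)"
        using assms(14)[OF i] by (simp add: fspace_def)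
      ultimately show ?thesis
        using mbounded_affine[OF \<open>homogeneous_metric dY\<close> _ _ S_le[OF i]] by auto
    qed
    then have "mbounded (\<Union>i\<in>{1..N}. \<Phi> f ` u i ` D i)"
      by (intro mbounded_Union) auto
    also have "(\<Union>i\<in>{1..N}. \<Phi> f ` u i ` D i) = \<Phi> f ` X"
      by (subst X) (simp only: image_UN)
    finally show ?thesis
      unfolding B_def fspace_def by (simp add: \<Phi>_def read_bajraktarevic_def)
  qed

  have contr: "d (\<Phi> f) (\<Phi> g) \<le> c * d f g" if f: "f \<in> B" and g: "g \<in> B" for f g
  proof -
    have pt: "dY (f x) (g x) \<le> d f g" if "x \<in> X" for x
      using funspace_mdist_le[of f X g "d f g"] f g that \<open>X \<noteq> {}\<close>
      unfolding B_def d_def by auto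
    have "dY (\<Phi> f y) (\<Phi> g y) \<le> c * d f g" if y: "y \<in> X" for y
    proof -
      obtain i x where i: "i \<in> {1..N}" and x: "x \<in> D i" and "y = u i x"
        using X y by blast
      then have "dY (\<Phi> f y) (\<Phi> g y) = \<bar>S i x\<bar> * dY (f x) (g x)"
        using Phi_u[OF i x] dist_affine(1)[OF \<open>homogeneous_metric dY\<close>] by simp
      also have "\<dots> \<le> c * d f g"
        using S_le[OF i x] pt[of x] D[OF i] x \<open>c \<ge> 0\<close> by (intro mult_mono) auto
      finally show ?thesis .
    qed
    then show ?thesis
      using funspace_mdist_le[of "\<Phi> f" X "\<Phi> g"] Phi_B f g \<open>X \<noteq> {}\<close>
      unfolding B_def d_def by auto
  qed
  have contractive: "contractive_on B d \<Phi>"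
    unfolding contractive_on_def using contr \<open>c \<ge> 0\<close> \<open>c < 1\<close> by blast

  have equiv: "(\<forall>x\<in>X. f x = ?rhs f x) \<longleftrightarrow>
      (\<forall>i\<in>{1..N}. \<forall>x\<in>D i. f (u i x) = lam i x + S i x *\<^sub>R restrict f (D i) x)" (is "?L \<longleftrightarrow> ?R") for f
  proof
    assume L: ?L
    show ?R
    proof (intro ballI)
      fix i x assume i: "i \<in> {1..N}" "x \<in> D i"
      show "f (u i x) = lam i x + S i x *\<^sub>R restrict f (D i) x"
        using bspec[OF L uX[OF i]] rhs[OF i] by (rule trans)
    qed
  next
    assume R: ?R
    show ?L
    proof
      fix y assume "y \<in> X"
      then obtain i x where i: "i \<in> {1..N}" "x \<in> D i" and y: "y = u i x"
        using X by blast
      show "f y = ?rhs f y"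
        unfolding y rhs[OF i] using R i by blast
    qed
  qed

  have "(\<lambda>x\<in>X. 0) \<in> B"
    unfolding B_def fspace_def mbounded_iff_dist_zero by auto
  then obtain f where f: "f \<in> B" "\<Phi> f = f" and unique: "\<forall>g\<in>B. \<Phi> g = g \<longrightarrow> g = f"
    using BX.contractive_on_imp_ex_unique_fixpoint[OF complete _ _ contractive] Phi_B by blast
  have "\<forall>x\<in>X. f x = ?rhs f x"
    using Phi_X[of _ f] unfolding f(2) by blast
  with f unique equiv[of f]
  have "\<exists>f\<in>B. \<Phi> f = f \<and> (\<forall>g\<in>B. \<Phi> g = g \<longrightarrow> g = f) \<and> (\<forall>x\<in>X. f x = ?rhs f x) \<and>
      (\<forall>i\<in>{1..N}. \<forall>x\<in>D i. f (u i x) = lam i x + S i x *\<^sub>R restrict f (D i) x)"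
    by blast
  moreover have "\<Phi> \<in> B \<rightarrow> B" using Phi_B by blast
  ultimately show ?thesis
    using BX.Metric_space_axioms complete contractive equiv by (intro conjI ballI)
qed

end
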